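(* Let $X$ be a locally path connected space and $x_0\in X$. Then $\pi_1^{\mathrm{pSpan}}(X,x_0)$ is discrete if and only if $\pi_1^{\mathrm{Span}}(X,x_0)$ is discrete.
   Context: For an open cover $\mathcal U$ of $X$, the Spanier subgroup $\pi(\mathcal U,x_0)$ is the subgroup of $\pi_1(X,x_0)$ generated by all classes $[\alpha*\beta*\alpha^{-1}]$, where $\alpha$ is a path in $X$ starting at $x_0$ and $\beta$ is a loop based at $\alpha(1)$ lying in some $U\in\mathcal U$. The space $\pi_1^{\mathrm{Span}}(X,x_0)$ is $\pi_1(X,x_0)$ with the topology having as a basis all left cosets $g\,\pi(\mathcal U,x_0)$, where $g\in\pi_1(X,x_0)$ and $\mathcal U$ is an open cover of $X$. Let $P(X,x_0)$ be the set of paths in $X$ starting at $x_0$. A path open cover is a family $\mathcal V=\{V_\alpha\mid\alpha\in P(X,x_0)\}$ of open subsets of $X$ with $\alpha(1)\in V_\alpha$. The path Spanier subgroup $\widetilde\pi(\mathcal V,x_0)$ is the subgroup of $\pi_1(X,x_0)$ consisting of all classes with a representative of the form $\prod_{j=1}^n\alpha_j*\beta_j*\alpha_j^{-1}$, where $\alpha_j\in P(X,x_0)$ and $\beta_j$ is a loop based at $\alpha_j(1)$ lying in $V_{\alpha_j}$. The space $\pi_1^{\mathrm{pSpan}}(X,x_0)$ is $\pi_1(X,x_0)$ with the topology having as a basis all left cosets $g\,\widetilde\pi(\mathcal V,x_0)$, where $g\in\pi_1(X,x_0)$ and $\mathcal V$ is a path open cover. *)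

theory Defs
  imports "HOL-Analysis.Analysis" "HOL-Algebra.Coset" "HOL-Algebra.Generated_Groups"
begin

section \<open>The fundamental group\<close>

text \<open>
  A space is a set \<open>S\<close> in an arbitrary topological space, with the subspace topology
  \<open>top_of_set S\<close>.
\<close>

definition loops_at :: "'a::topological_space set \<Rightarrow> 'a \<Rightarrow> (real \<Rightarrow> 'a) set"
  where "loops_at S x =
    {p. path p \<and> path_image p \<subseteq> S \<and> pathstart p = x \<and> pathfinish p = x}"

definition path_class :: "'a::topological_space set \<Rightarrow> (real \<Rightarrow> 'a) \<Rightarrow> (real \<Rightarrow> 'a) set"
  where "path_class S p = {q. homotopic_paths S p q}"

text \<open>
  The constant path is written \<open>\<lambda>_. x0\<close>, because \<open>linepath\<close> is restricted to normed vector
  spaces. That multiplication is induced by concatenation is \<open>fundamental_group_mult\<close> below.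
\<close>

definition fundamental_group :: "'a::topological_space set \<Rightarrow> 'a \<Rightarrow> (real \<Rightarrow> 'a) set monoid"
  where "fundamental_group S x0 =
    \<lparr>carrier = path_class S ` loops_at S x0,
     mult = (\<lambda>A B. {r. \<exists>p\<in>A. \<exists>q\<in>B. homotopic_paths S (p +++ q) r}),
     one = path_class S (\<lambda>_. x0)\<rparr>"


section \<open>Spanier subgroups and the two topologies\<close>

text \<open>
  Library paths are total functions on the reals of which only the restriction to
  \<open>{0..1}\<close> matters. Path open covers are indexed by paths, so here a path must be determined
  by that restriction; otherwise one path would get several index values.
\<close>

definition paths_from :: "'a::topological_space set \<Rightarrow> 'a \<Rightarrow> (real \<Rightarrow> 'a) set"
  where "paths_from S x0 =
    {p \<in> extensional {0..1}. path p \<and> path_image p \<subseteq> S \<and> pathstart p = x0}"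

definition conj_loop :: "(real \<Rightarrow> 'a::topological_space) \<Rightarrow> (real \<Rightarrow> 'a) \<Rightarrow> real \<Rightarrow> 'a"
  where "conj_loop \<alpha> \<beta> = \<alpha> +++ \<beta> +++ reversepath \<alpha>"

definition open_cover :: "'a::topological_space set \<Rightarrow> 'a set set \<Rightarrow> bool"
  where "open_cover S \<U> \<longleftrightarrow> (\<forall>U\<in>\<U>. openin (top_of_set S) U) \<and> \<Union>\<U> = S"

definition Spanier_subgroup ::
    "'a::topological_space set \<Rightarrow> 'a set set \<Rightarrow> 'a \<Rightarrow> (real \<Rightarrow> 'a) set set"
  where "Spanier_subgroup S \<U> x0 =
    generate (fundamental_group S x0)
      {path_class S (conj_loop \<alpha> \<beta>) |\<alpha> \<beta> U.
         \<alpha> \<in> paths_from S x0 \<and> U \<in> \<U> \<and> \<beta> \<in> loops_at U (pathfinish \<alpha>)}"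

definition path_open_cover ::
    "'a::topological_space set \<Rightarrow> 'a \<Rightarrow> ((real \<Rightarrow> 'a) \<Rightarrow> 'a set) \<Rightarrow> bool"
  where "path_open_cover S x0 V \<longleftrightarrow>
    (\<forall>\<alpha>\<in>paths_from S x0. openin (top_of_set S) (V \<alpha>) \<and> pathfinish \<alpha> \<in> V \<alpha>)"

text \<open>The empty product is the constant path at the base point.\<close>

fun path_prod :: "'a::topological_space \<Rightarrow> (real \<Rightarrow> 'a) list \<Rightarrow> real \<Rightarrow> 'a"
  where
    "path_prod x0 [] = (\<lambda>_. x0)"
  | "path_prod x0 [p] = p"
  | "path_prod x0 (p # q # ps) = p +++ path_prod x0 (q # ps)"

definition path_Spanier_subgroup ::
    "'a::topological_space set \<Rightarrow> ((real \<Rightarrow> 'a) \<Rightarrow> 'a set) \<Rightarrow> 'a \<Rightarrow> (real \<Rightarrow> 'a) set set"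
  where "path_Spanier_subgroup S V x0 =
    {path_class S (path_prod x0 (map (\<lambda>(\<alpha>, \<beta>). conj_loop \<alpha> \<beta>) l)) |l.
       \<forall>(\<alpha>, \<beta>)\<in>set l. \<alpha> \<in> paths_from S x0 \<and> \<beta> \<in> loops_at (V \<alpha>) (pathfinish \<alpha>)}"

definition Spanier_basis :: "'a::topological_space set \<Rightarrow> 'a \<Rightarrow> (real \<Rightarrow> 'a) set set set"
  where "Spanier_basis S x0 =
    {g <#\<^bsub>fundamental_group S x0\<^esub> Spanier_subgroup S \<U> x0 |g \<U>.
       g \<in> carrier (fundamental_group S x0) \<and> open_cover S \<U>}"

definition path_Spanier_basis :: "'a::topological_space set \<Rightarrow> 'a \<Rightarrow> (real \<Rightarrow> 'a) set set set"
  where "path_Spanier_basis S x0 =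
    {g <#\<^bsub>fundamental_group S x0\<^esub> path_Spanier_subgroup S V x0 |g V.
       g \<in> carrier (fundamental_group S x0) \<and> path_open_cover S x0 V}"

text \<open>
  \<open>topology_generated_by\<close> only asks for a subbasis; that these families are bases is
  \<open>openin_pi1_Span\<close> and \<open>openin_pi1_pSpan\<close> below.
\<close>

definition pi1_Span :: "'a::topological_space set \<Rightarrow> 'a \<Rightarrow> (real \<Rightarrow> 'a) set topology"
  where "pi1_Span S x0 = topology_generated_by (Spanier_basis S x0)"

definition pi1_pSpan :: "'a::topological_space set \<Rightarrow> 'a \<Rightarrow> (real \<Rightarrow> 'a) set topology"
  where "pi1_pSpan S x0 = topology_generated_by (path_Spanier_basis S x0)"


section \<open>The definitions are as intended\<close>

subsection \<open>Group laws\<close>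

lemma homotopic_paths_const_right:
  assumes "path p" "path_image p \<subseteq> S" "pathfinish p = x"
  shows "homotopic_paths S (p +++ (\<lambda>_. x)) p"
proof -
  have \<section>: "continuous_on {0..1} (\<lambda>t::real. if t \<le> 1/2 then 2 *\<^sub>R t else 1)"
    unfolding split_01
    by (rule continuous_on_cases continuous_intros | force simp: pathfinish_def joinpaths_def)+
  show ?thesis
    apply (rule homotopic_paths_sym)
    using assms unfolding pathfinish_def joinpaths_def
    by (intro \<section> continuous_on_cases continuous_intros
        homotopic_paths_reparametrize [where f = "\<lambda>t. if t \<le> 1/2 then 2 *\<^sub>R t else 1"]; force)
qed

lemma homotopic_paths_const_left:
  assumes "path p" "path_image p \<subseteq> S" "pathstart p = x"
  shows "homotopic_paths S ((\<lambda>_. x) +++ p) p"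
proof -
  have c: "reversepath (\<lambda>_::real. x) = (\<lambda>_. x)"
    by (simp add: reversepath_def)
  have "homotopic_paths S (reversepath p +++ (\<lambda>_. x)) (reversepath p)"
    using assms by (intro homotopic_paths_const_right) auto
  then have "homotopic_paths S (reversepath (reversepath p +++ (\<lambda>_. x))) (reversepath (reversepath p))"
    by (rule homotopic_paths_reversepath_D)
  then show ?thesis
    using assms c by (simp add: reversepath_joinpaths pathstart_def[of "\<lambda>_. x"])
qed

lemma homotopic_paths_reverse_right:
  assumes "path p" "path_image p \<subseteq> S"
  shows "homotopic_paths S (p +++ reversepath p) (\<lambda>_. pathstart p)"
proof -
  have p: "continuous_on {0..1} p" 
    using assms by (auto simp: path_def)
  let ?A = "{0..1} \<times> {0..1}"
  let ?q = "\<lambda>s t. p (s * t)"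
  have "continuous_on ?A (\<lambda>x. (?q (fst x) +++ reversepath (?q (fst x))) (snd x))"
    unfolding joinpaths_def reversepath_def
  proof (rule continuous_on_cases_le)
    show "continuous_on {x \<in> ?A. snd x \<le> 1/2} (\<lambda>t. p (fst t * (2 * snd t)))"
         "continuous_on {x \<in> ?A. 1/2 \<le> snd x} (\<lambda>t. p (fst t * (1 - (2 * snd t - 1))))"
         "continuous_on ?A snd"
      by (intro continuous_on_compose2 [OF p] continuous_intros; auto simp: mult_le_one)+
  qed (auto simp: algebra_simps)
  then show ?thesis
    using assms
    apply (subst homotopic_paths_sym_eq)
    unfolding homotopic_paths_def homotopic_with_def
    apply (rule_tac x="(\<lambda>y. (?q (fst y) +++ reversepath(?q (fst y))) (snd y))" in exI)
    apply (force simp: mult_le_one path_defs joinpaths_def reversepath_def)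
    done
qed

lemma path_class_eq_iff:
  assumes "p \<in> loops_at S x"
  shows "path_class S p = path_class S q \<longleftrightarrow> homotopic_paths S p q"
  using assms unfolding path_class_def loops_at_def
  by (auto intro: homotopic_paths_trans homotopic_paths_sym)

lemma path_class_eqI: "homotopic_paths S p q \<Longrightarrow> path_class S p = path_class S q"
  unfolding path_class_def by (auto intro: homotopic_paths_trans homotopic_paths_sym)

lemma loops_at_join: "p \<in> loops_at S x \<Longrightarrow> q \<in> loops_at S x \<Longrightarrow> p +++ q \<in> loops_at S x"
  by (auto simp: loops_at_def subset_path_image_join)

lemma loops_at_const: "x \<in> S \<Longrightarrow> (\<lambda>_. x) \<in> loops_at S x"
  by (auto simp: loops_at_def path_def path_image_def pathstart_def pathfinish_def)

lemma loops_at_reverse: "p \<in> loops_at S x \<Longrightarrow> reversepath p \<in> loops_at S x"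
  by (auto simp: loops_at_def)

lemma loops_at_mono: "p \<in> loops_at U x \<Longrightarrow> U \<subseteq> S \<Longrightarrow> p \<in> loops_at S x"
  by (auto simp: loops_at_def)

lemma fundamental_group_mult:
  assumes "p \<in> loops_at S x0" "q \<in> loops_at S x0"
  shows "path_class S p \<otimes>\<^bsub>fundamental_group S x0\<^esub> path_class S q = path_class S (p +++ q)"
proof -
  have "homotopic_paths S (p +++ q) r"
    if "homotopic_paths S p p'" "homotopic_paths S q q'" "homotopic_paths S (p' +++ q') r" for p' q' r
    using assms that
    by (intro homotopic_paths_trans[OF homotopic_paths_join[OF that(1,2)] that(3)])
       (auto simp: loops_at_def)
  moreover have "homotopic_paths S p p" "homotopic_paths S q q"
    using assms by (auto simp: loops_at_def)
  ultimately show ?thesis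
    unfolding fundamental_group_def path_class_def monoid.simps by blast
qed

lemma carrier_fundamental_group:
  "carrier (fundamental_group S x0) = path_class S ` loops_at S x0"
  by (simp add: fundamental_group_def)

lemma one_fundamental_group:
  "\<one>\<^bsub>fundamental_group S x0\<^esub> = path_class S (\<lambda>_. x0)"
  by (simp add: fundamental_group_def)

lemma fundamental_group_linv:
  assumes "p \<in> loops_at S x0"
  shows "path_class S (reversepath p) \<otimes>\<^bsub>fundamental_group S x0\<^esub> path_class S p
    = \<one>\<^bsub>fundamental_group S x0\<^esub>"
proof -
  have "homotopic_paths S (reversepath p +++ p) (\<lambda>_. x0)"
    using assms homotopic_paths_reverse_right[of "reversepath p" S] by (auto simp: loops_at_def)
  then show ?thesis
    using assms
    by (simp add: fundamental_group_mult loops_at_reverse one_fundamental_group path_class_eqI)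
qed

lemma group_fundamental_group:
  assumes "x0 \<in> S"
  shows "group (fundamental_group S x0)"
proof (rule groupI)
  fix A B assume "A \<in> carrier (fundamental_group S x0)" "B \<in> carrier (fundamental_group S x0)"
  then show "A \<otimes>\<^bsub>fundamental_group S x0\<^esub> B \<in> carrier (fundamental_group S x0)"
    by (auto simp: carrier_fundamental_group fundamental_group_mult intro: loops_at_join)
next
  show "\<one>\<^bsub>fundamental_group S x0\<^esub> \<in> carrier (fundamental_group S x0)"
    using loops_at_const[OF assms] by (auto simp: carrier_fundamental_group one_fundamental_group)
next
  fix A B C
  assume "A \<in> carrier (fundamental_group S x0)" "B \<in> carrier (fundamental_group S x0)"
    "C \<in> carrier (fundamental_group S x0)"
  then obtain p q r where *: "p \<in> loops_at S x0" "q \<in> loops_at S x0" "r \<in> loops_at S x0"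
    "A = path_class S p" "B = path_class S q" "C = path_class S r"
    by (auto simp: carrier_fundamental_group)
  have "homotopic_paths S (p +++ (q +++ r)) ((p +++ q) +++ r)"
    using * by (intro homotopic_paths_assoc) (auto simp: loops_at_def)
  then show "A \<otimes>\<^bsub>fundamental_group S x0\<^esub> B \<otimes>\<^bsub>fundamental_group S x0\<^esub> C
    = A \<otimes>\<^bsub>fundamental_group S x0\<^esub> (B \<otimes>\<^bsub>fundamental_group S x0\<^esub> C)"
    using * by (simp add: fundamental_group_mult loops_at_join path_class_eqI)
next
  fix A assume "A \<in> carrier (fundamental_group S x0)"
  then obtain p where p: "p \<in> loops_at S x0" "A = path_class S p"
    by (auto simp: carrier_fundamental_group)
  then have "homotopic_paths S ((\<lambda>_. x0) +++ p) p"
    by (intro homotopic_paths_const_left) (auto simp: loops_at_def)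
  then show "\<one>\<^bsub>fundamental_group S x0\<^esub> \<otimes>\<^bsub>fundamental_group S x0\<^esub> A = A"
    using p loops_at_const[OF assms]
    by (simp add: fundamental_group_mult one_fundamental_group path_class_eqI)
  show "\<exists>B\<in>carrier (fundamental_group S x0).
      B \<otimes>\<^bsub>fundamental_group S x0\<^esub> A = \<one>\<^bsub>fundamental_group S x0\<^esub>"
    using p fundamental_group_linv loops_at_reverse by (fastforce simp: carrier_fundamental_group)
qed

lemma inv_fundamental_group:
  assumes "x0 \<in> S" "p \<in> loops_at S x0"
  shows "inv\<^bsub>fundamental_group S x0\<^esub> path_class S p = path_class S (reversepath p)"
  using assms
  by (intro group.inv_equality group_fundamental_group fundamental_group_linv)
     (auto simp: carrier_fundamental_group loops_at_reverse)

subsection \<open>Subgroups\<close>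

lemma conj_loop_in_loops_at:
  assumes "\<alpha> \<in> paths_from S x0" "\<beta> \<in> loops_at U (pathfinish \<alpha>)" "U \<subseteq> S"
  shows "conj_loop \<alpha> \<beta> \<in> loops_at S x0"
proof -
  have "path_image (conj_loop \<alpha> \<beta>) \<subseteq> S"
    unfolding conj_loop_def
    using assms by (intro subset_path_image_join) (auto simp: paths_from_def loops_at_def)
  then show ?thesis
    using assms by (auto simp: conj_loop_def paths_from_def loops_at_def)
qed

lemma reversepath_conj_loop:
  assumes "\<alpha> \<in> paths_from S x0" "\<beta> \<in> loops_at U (pathfinish \<alpha>)" "U \<subseteq> S"
  shows "path_class S (reversepath (conj_loop \<alpha> \<beta>)) = path_class S (conj_loop \<alpha> (reversepath \<beta>))"
proof -
  have "reversepath (conj_loop \<alpha> \<beta>) = (\<alpha> +++ reversepath \<beta>) +++ reversepath \<alpha>"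
    using assms by (simp add: conj_loop_def reversepath_joinpaths loops_at_def)
  moreover have "homotopic_paths S (conj_loop \<alpha> (reversepath \<beta>)) \<dots>"
    unfolding conj_loop_def
    using assms by (intro homotopic_paths_assoc) (auto simp: loops_at_def paths_from_def)
  ultimately show ?thesis
    by (metis path_class_eqI)
qed

lemma subgroup_Spanier:
  assumes "x0 \<in> S" "open_cover S \<U>"
  shows "subgroup (Spanier_subgroup S \<U> x0) (fundamental_group S x0)"
  unfolding Spanier_subgroup_def
proof (intro group.generate_is_subgroup group_fundamental_group assms(1) subsetI)
  fix c assume "c \<in> {path_class S (conj_loop \<alpha> \<beta>) |\<alpha> \<beta> U.
         \<alpha> \<in> paths_from S x0 \<and> U \<in> \<U> \<and> \<beta> \<in> loops_at U (pathfinish \<alpha>)}"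
  then show "c \<in> carrier (fundamental_group S x0)"
    using assms(2) conj_loop_in_loops_at
    by (force simp: carrier_fundamental_group open_cover_def)
qed

lemma path_prod_in_loops_at:
  assumes "x0 \<in> S" "set ps \<subseteq> loops_at S x0"
  shows "path_prod x0 ps \<in> loops_at S x0"
  using assms by (induction x0 ps rule: path_prod.induct) (auto simp: loops_at_const intro: loops_at_join)

lemma path_class_path_prod_Cons:
  assumes "x0 \<in> S" "p \<in> loops_at S x0" "set ps \<subseteq> loops_at S x0"
  shows "path_class S (path_prod x0 (p # ps)) =
    path_class S p \<otimes>\<^bsub>fundamental_group S x0\<^esub> path_class S (path_prod x0 ps)"
proof (cases ps)
  case Nil
  interpret group "fundamental_group S x0"
    using assms(1) by (rule group_fundamental_group)
  show ?thesis
    using Nil assms r_one[of "path_class S p"]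
    by (simp add: one_fundamental_group carrier_fundamental_group)
next
  case (Cons q qs)
  then have "path_prod x0 (q # qs) \<in> loops_at S x0"
    using assms path_prod_in_loops_at by blast
  then show ?thesis
    using Cons assms by (simp add: fundamental_group_mult)
qed

lemma path_Spanier_subgroup_eq_generate:
  assumes "x0 \<in> S" "path_open_cover S x0 V"
  shows "path_Spanier_subgroup S V x0 =
    generate (fundamental_group S x0)
      {path_class S (conj_loop \<alpha> \<beta>) |\<alpha> \<beta>.
         \<alpha> \<in> paths_from S x0 \<and> \<beta> \<in> loops_at (V \<alpha>) (pathfinish \<alpha>)}"
    (is "?L = generate ?G ?gens")
proof
  interpret group "?G"
    using assms(1) by (rule group_fundamental_group)
  let ?ok = "\<lambda>l. \<forall>(\<alpha>, \<beta>)\<in>set l. \<alpha> \<in> paths_from S x0 \<and> \<beta> \<in> loops_at (V \<alpha>) (pathfinish \<alpha>)"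
  let ?P = "\<lambda>l. path_class S (path_prod x0 (map (\<lambda>(\<alpha>, \<beta>). conj_loop \<alpha> \<beta>) l))"
  have V: "V \<alpha> \<subseteq> S" if "\<alpha> \<in> paths_from S x0" for \<alpha>
    using assms(2) that by (auto simp: path_open_cover_def dest: openin_imp_subset)
  have loops: "conj_loop \<alpha> \<beta> \<in> loops_at S x0"
    if "\<alpha> \<in> paths_from S x0" "\<beta> \<in> loops_at (V \<alpha>) (pathfinish \<alpha>)" for \<alpha> \<beta>
    using conj_loop_in_loops_at[OF that] V[OF that(1)] by blast
  have sub: "set (map (\<lambda>(\<alpha>, \<beta>). conj_loop \<alpha> \<beta>) l) \<subseteq> loops_at S x0" if "?ok l" for l
    using that loops by auto
  have carr: "?P l \<in> carrier ?G" if "?ok l" for l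
    unfolding carrier_fundamental_group
    by (intro imageI path_prod_in_loops_at assms(1) sub that)
  have PCons: "?P ((\<alpha>, \<beta>) # l) = path_class S (conj_loop \<alpha> \<beta>) \<otimes>\<^bsub>?G\<^esub> ?P l" if "?ok ((\<alpha>, \<beta>) # l)" for \<alpha> \<beta> l
    using path_class_path_prod_Cons[OF assms(1) loops sub[of l], of \<alpha> \<beta>] that by simp
  have "?P l \<in> generate ?G ?gens" if "?ok l" for l
    using that
  proof (induction l)
    case Nil
    then show ?case
      using generate.one[of ?G ?gens] by (simp add: one_fundamental_group)
  next
    case (Cons a l)
    obtain \<alpha> \<beta> where a: "a = (\<alpha>, \<beta>)" by (cases a)
    have "path_class S (conj_loop \<alpha> \<beta>) \<in> generate ?G ?gens"
      using Cons.prems a by (intro generate.incl) auto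
    then have "path_class S (conj_loop \<alpha> \<beta>) \<otimes>\<^bsub>?G\<^esub> ?P l \<in> generate ?G ?gens"
      using Cons by (intro generate.eng) auto
    then show ?case
      unfolding a using Cons.prems[unfolded a] by (subst PCons)
  qed
  then show "?L \<subseteq> generate ?G ?gens"
    unfolding path_Spanier_subgroup_def by blast
  have app: "?P (l @ m) = ?P l \<otimes>\<^bsub>?G\<^esub> ?P m" if "?ok l" "?ok m" for l m
    using that(1)
  proof (induction l)
    case Nil
    then show ?case
      using carr[OF that(2)] l_one by (simp add: one_fundamental_group)
  next
    case (Cons a l)
    obtain \<alpha> \<beta> where a: "a = (\<alpha>, \<beta>)" by (cases a)
    have ok: "?ok ((\<alpha>, \<beta>) # l)" "?ok ((\<alpha>, \<beta>) # (l @ m))" "?ok l"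
      using Cons.prems that(2) unfolding a by auto
    have c: "path_class S (conj_loop \<alpha> \<beta>) \<in> carrier ?G"
      unfolding carrier_fundamental_group using ok(1) loops by auto
    have "?P (a # l @ m) = path_class S (conj_loop \<alpha> \<beta>) \<otimes>\<^bsub>?G\<^esub> (?P l \<otimes>\<^bsub>?G\<^esub> ?P m)"
      using PCons[OF ok(2)] Cons.IH[OF ok(3)] unfolding a by simp
    also have "\<dots> = ?P (a # l) \<otimes>\<^bsub>?G\<^esub> ?P m"
      unfolding a PCons[OF ok(1)] by (rule m_assoc[OF c carr[OF ok(3)] carr[OF that(2)], symmetric])
    finally show ?case by simp
  qed
  have gen: "path_class S (conj_loop \<alpha> \<beta>) \<in> ?L"
    if "\<alpha> \<in> paths_from S x0" "\<beta> \<in> loops_at (V \<alpha>) (pathfinish \<alpha>)" for \<alpha> \<beta>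
    unfolding path_Spanier_subgroup_def
    using that by (intro CollectI exI[of _ "[(\<alpha>, \<beta>)]"]) auto
  show "generate ?G ?gens \<subseteq> ?L"
  proof
    fix c assume "c \<in> generate ?G ?gens"
    then show "c \<in> ?L"
    proof induction
      case one
      show ?case
        unfolding path_Spanier_subgroup_def one_fundamental_group
        by (intro CollectI exI[of _ "[]"]) auto
    next
      case (incl h)
      then show ?case using gen by blast
    next
      case (inv h)
      then obtain \<alpha> \<beta> where h: "h = path_class S (conj_loop \<alpha> \<beta>)"
        "\<alpha> \<in> paths_from S x0" "\<beta> \<in> loops_at (V \<alpha>) (pathfinish \<alpha>)" by blast
      have "inv\<^bsub>?G\<^esub> h = path_class S (conj_loop \<alpha> (reversepath \<beta>))"
        using inv_fundamental_group[OF assms(1) loops] reversepath_conj_loop[OF h(2,3)] V h by simp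
      then show ?case
        using gen[OF h(2) loops_at_reverse[OF h(3)]] by simp
    next
      case (eng h1 h2)
      then obtain l m where "?ok l" "?ok m" "h1 = ?P l" "h2 = ?P m"
        unfolding path_Spanier_subgroup_def by blast
      then show ?case
        unfolding path_Spanier_subgroup_def using app
        by (intro CollectI exI[of _ "l @ m"]) auto
    qed
  qed
qed

lemma subgroup_path_Spanier:
  assumes "x0 \<in> S" "path_open_cover S x0 V"
  shows "subgroup (path_Spanier_subgroup S V x0) (fundamental_group S x0)"
  unfolding path_Spanier_subgroup_eq_generate[OF assms]
proof (intro group.generate_is_subgroup group_fundamental_group assms(1) subsetI)
  fix c assume "c \<in> {path_class S (conj_loop \<alpha> \<beta>) |\<alpha> \<beta>.
         \<alpha> \<in> paths_from S x0 \<and> \<beta> \<in> loops_at (V \<alpha>) (pathfinish \<alpha>)}"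
  then obtain \<alpha> \<beta> where *: "c = path_class S (conj_loop \<alpha> \<beta>)"
     "\<alpha> \<in> paths_from S x0" "\<beta> \<in> loops_at (V \<alpha>) (pathfinish \<alpha>)" by blast
  moreover have "V \<alpha> \<subseteq> S"
    using * assms(2) by (auto simp: path_open_cover_def dest: openin_imp_subset)
  ultimately show "c \<in> carrier (fundamental_group S x0)"
    using conj_loop_in_loops_at by (fastforce simp: carrier_fundamental_group)
qed

subsection \<open>The cosets form bases\<close>

lemma (in group) openin_coset_topology:
  assumes sub: "\<And>i. P i \<Longrightarrow> subgroup (H i) G"
    and dir: "\<And>i j. P i \<Longrightarrow> P j \<Longrightarrow> \<exists>k. P k \<and> H k \<subseteq> H i \<inter> H j"
    and ex: "P i0"
  shows "openin (topology_generated_by {g <# H i |g i. g \<in> carrier G \<and> P i})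
       = arbitrary union_of (\<lambda>W. W \<in> {g <# H i |g i. g \<in> carrier G \<and> P i})"
    (is "openin (topology_generated_by ?B) = _")
    and "topspace (topology_generated_by {g <# H i |g i. g \<in> carrier G \<and> P i}) = carrier G"
proof -
  have mem: "x \<in> x <# H i" if "x \<in> carrier G" "P i" for x i
    using that sub[THEN subgroup.one_closed] r_one[OF that(1)] unfolding l_coset_def by force
  have step: "x <# H i \<subseteq> g <# H i" "x \<in> carrier G"
    if 1: "g \<in> carrier G" and 2: "P i" and 3: "x \<in> g <# H i" for x g i
  proof -
    obtain h where h: "h \<in> H i" "x = g \<otimes> h"
      using 3 unfolding l_coset_def by blast
    interpret H: subgroup "H i" G using sub 2 by blast
    show "x \<in> carrier G" using h 1 by simp
    show "x <# H i \<subseteq> g <# H i"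
    proof
      fix y assume "y \<in> x <# H i"
      then obtain k where "k \<in> H i" "y = x \<otimes> k" unfolding l_coset_def by blast
      then have "y = g \<otimes> (h \<otimes> k)" "h \<otimes> k \<in> H i"
        using h 1 by (auto simp: m_assoc)
      then show "y \<in> g <# H i" unfolding l_coset_def by blast
    qed
  qed
  have istop: "istopology (arbitrary union_of (\<lambda>W. W \<in> ?B))"
  proof (rule istopology_base_alt[THEN iffD2], intro allI impI, elim conjE)
    fix A B assume "(arbitrary union_of (\<lambda>W. W \<in> ?B)) A" "(arbitrary union_of (\<lambda>W. W \<in> ?B)) B"
    then have AB: "\<forall>x\<in>A. \<exists>U. U \<in> ?B \<and> x \<in> U \<and> U \<subseteq> A" "\<forall>x\<in>B. \<exists>U. U \<in> ?B \<and> x \<in> U \<and> U \<subseteq> B"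
      unfolding arbitrary_union_of_alt by simp_all
    show "(arbitrary union_of (\<lambda>W. W \<in> ?B)) (A \<inter> B)"
      unfolding arbitrary_union_of_alt
    proof
      fix x assume "x \<in> A \<inter> B"
      then obtain U U' where U: "U \<in> ?B" "x \<in> U" "U \<subseteq> A" "U' \<in> ?B" "x \<in> U'" "U' \<subseteq> B"
        using AB by (meson IntD1 IntD2)
      then obtain g i g' j where *: "g \<in> carrier G" "P i" "x \<in> g <# H i" "g <# H i \<subseteq> A"
        "g' \<in> carrier G" "P j" "x \<in> g' <# H j" "g' <# H j \<subseteq> B"
        by blast
      obtain k where k: "P k" "H k \<subseteq> H i \<inter> H j" using dir[OF *(2,6)] by blast
      have x: "x \<in> carrier G" using step(2)[OF *(1-3)] .
      have "x <# H k \<subseteq> x <# H i" "x <# H k \<subseteq> x <# H j"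
        using k unfolding l_coset_def by blast+
      then have "x <# H k \<subseteq> A \<inter> B" using step(1)[OF *(1-3)] step(1)[OF *(5-7)] *(4,8) by blast
      then show "\<exists>U. U \<in> ?B \<and> x \<in> U \<and> U \<subseteq> A \<inter> B"
        using x k(1) mem[OF x k(1)] by (intro exI[of _ "x <# H k"]) blast
    qed
  qed
  let ?T = "topology (arbitrary union_of (\<lambda>W. W \<in> ?B))"
  have op: "openin (topology (arbitrary union_of (\<lambda>W. W \<in> ?B))) = arbitrary union_of (\<lambda>W. W \<in> ?B)"
    using istop by (rule topology_inverse')
  have "generate_topology_on ?B W \<longleftrightarrow> (arbitrary union_of (\<lambda>W. W \<in> ?B)) W" for W
  proof
    assume "generate_topology_on ?B W"
    then show "(arbitrary union_of (\<lambda>W. W \<in> ?B)) W"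
    proof (induction)
      case Empty
      show ?case using openin_empty[of ?T] by (simp only: op)
    next
      case (Int a b)
      then show ?case using openin_Int[of ?T a b] by (simp only: op)
    next
      case (UN K)
      then show ?case using openin_Union[of K ?T] by (simp only: op)
    next
      case (Basis s)
      then show ?case by (rule arbitrary_union_of_inc)
    qed
  next
    assume "(arbitrary union_of (\<lambda>W. W \<in> ?B)) W"
    then obtain \<W> where W: "\<W> \<subseteq> Collect (\<lambda>W. W \<in> ?B)" "\<Union>\<W> = W"
      unfolding union_of_def by auto
    have "generate_topology_on ?B (\<Union>\<W>)"
    proof (rule generate_topology_on.UN)
      fix k assume "k \<in> \<W>"
      then have "k \<in> ?B" using W(1) by blast
      then show "generate_topology_on ?B k" by (rule generate_topology_on.Basis)
    qed
    then show "generate_topology_on ?B W" unfolding W(2) .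
  qed
  then show "openin (topology_generated_by ?B) = arbitrary union_of (\<lambda>W. W \<in> ?B)"
    by (simp add: fun_eq_iff openin_topology_generated_by_iff)
  show "topspace (topology_generated_by ?B) = carrier G"
    unfolding topology_generated_by_topspace
  proof
    show "\<Union>?B \<subseteq> carrier G" using step(2) by blast
    show "carrier G \<subseteq> \<Union>?B"
    proof
      fix x assume "x \<in> carrier G"
      then have "x <# H i0 \<in> ?B" "x \<in> x <# H i0" using ex mem by blast+
      then show "x \<in> \<Union>?B" by (rule UnionI)
    qed
  qed
qed

lemma
  assumes "x0 \<in> S"
  shows openin_pi1_Span:
      "openin (pi1_Span S x0) = arbitrary union_of (\<lambda>W. W \<in> Spanier_basis S x0)"
    and topspace_pi1_Span: "topspace (pi1_Span S x0) = carrier (fundamental_group S x0)"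
proof -
  have dir: "\<exists>\<W>. open_cover S \<W> \<and>
      Spanier_subgroup S \<W> x0 \<subseteq> Spanier_subgroup S \<U> x0 \<inter> Spanier_subgroup S \<V> x0"
    if "open_cover S \<U>" "open_cover S \<V>" for \<U> \<V>
  proof (intro exI conjI)
    let ?\<W> = "{U \<inter> V |U V. U \<in> \<U> \<and> V \<in> \<V>}"
    show "open_cover S ?\<W>"
      unfolding open_cover_def
    proof
      show "\<forall>W\<in>?\<W>. openin (top_of_set S) W"
        using that unfolding open_cover_def by auto
      have "\<Union>?\<W> = \<Union>\<U> \<inter> \<Union>\<V>"
        by blast
      then show "\<Union>?\<W> = S"
        using that unfolding open_cover_def by simp
    qed
    have "Spanier_subgroup S ?\<W> x0 \<subseteq> Spanier_subgroup S \<U> x0"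
      "Spanier_subgroup S ?\<W> x0 \<subseteq> Spanier_subgroup S \<V> x0"
      unfolding Spanier_subgroup_def
      by (intro group.mono_generate[OF group_fundamental_group[OF assms]],
          clarify, blast dest: loops_at_mono[OF _ Int_lower1] loops_at_mono[OF _ Int_lower2])+
    then show "Spanier_subgroup S ?\<W> x0 \<subseteq> Spanier_subgroup S \<U> x0 \<inter> Spanier_subgroup S \<V> x0"
      by blast
  qed
  have ex: "open_cover S {S}"
    by (simp add: open_cover_def)
  note * = group.openin_coset_topology[OF group_fundamental_group[OF assms],
      where P = "open_cover S" and H = "\<lambda>\<U>. Spanier_subgroup S \<U> x0",
      OF subgroup_Spanier[OF assms] dir ex]
  show "openin (pi1_Span S x0) = arbitrary union_of (\<lambda>W. W \<in> Spanier_basis S x0)"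
    unfolding pi1_Span_def Spanier_basis_def by (rule *(1))
  show "topspace (pi1_Span S x0) = carrier (fundamental_group S x0)"
    unfolding pi1_Span_def Spanier_basis_def by (rule *(2))
qed

lemma
  assumes "x0 \<in> S"
  shows openin_pi1_pSpan:
      "openin (pi1_pSpan S x0) = arbitrary union_of (\<lambda>W. W \<in> path_Spanier_basis S x0)"
    and topspace_pi1_pSpan: "topspace (pi1_pSpan S x0) = carrier (fundamental_group S x0)"
proof -
  have dir: "\<exists>W. path_open_cover S x0 W \<and>
      path_Spanier_subgroup S W x0 \<subseteq> path_Spanier_subgroup S U x0 \<inter> path_Spanier_subgroup S V x0"
    if "path_open_cover S x0 U" "path_open_cover S x0 V" for U V
  proof (intro exI conjI)
    let ?W = "\<lambda>\<alpha>. U \<alpha> \<inter> V \<alpha>"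
    show "path_open_cover S x0 ?W"
      using that unfolding path_open_cover_def by auto
    show "path_Spanier_subgroup S ?W x0 \<subseteq> path_Spanier_subgroup S U x0 \<inter> path_Spanier_subgroup S V x0"
      unfolding path_Spanier_subgroup_def loops_at_def by fastforce
  qed
  have ex: "path_open_cover S x0 (\<lambda>_. S)"
    by (auto simp: path_open_cover_def paths_from_def dest: pathfinish_in_path_image[THEN subsetD[rotated]])
  note * = group.openin_coset_topology[OF group_fundamental_group[OF assms],
      where P = "path_open_cover S x0" and H = "\<lambda>V. path_Spanier_subgroup S V x0",
      OF subgroup_path_Spanier[OF assms] dir ex]
  show "openin (pi1_pSpan S x0) = arbitrary union_of (\<lambda>W. W \<in> path_Spanier_basis S x0)"
    unfolding pi1_pSpan_def path_Spanier_basis_def by (rule *(1))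
  show "topspace (pi1_pSpan S x0) = carrier (fundamental_group S x0)"
    unfolding pi1_pSpan_def path_Spanier_basis_def by (rule *(2))
qed

end

theory Submission
  imports Defs
begin

text \<open>
  In a coset topology discreteness means that one of the defining subgroups is trivial. For the
  two Spanier topologies the defining subgroups are generated by classes of conjugates
  \<open>\<alpha> * \<beta> * \<alpha>\<^sup>-\<^sup>1\<close>, and such a conjugate is null-homotopic exactly when the small loop \<open>\<beta>\<close> is
  (\<open>conj_loop_null_iff\<close>). Hence both discreteness statements say that there is a cover of the
  relevant kind all of whose small loops at points reachable from \<open>x0\<close> are null-homotopic in \<open>S\<close>.

  A cover \<open>\<U>\<close> with this property yields a path open cover with this property: choose for each
  \<open>\<alpha>\<close> a member of \<open>\<U>\<close> containing the end point of \<open>\<alpha>\<close>.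

  Conversely, let the path open cover \<open>V\<close> have the property. It controls loops in \<open>V \<alpha>\<close> only if
  they are based at the single point \<open>\<alpha>(1)\<close>, whereas a cover must control loops at every point of
  its members. Here local path connectedness enters: \<open>\<alpha>(1)\<close> has a path connected open
  neighbourhood \<open>W \<subseteq> V \<alpha>\<close>, and a loop in \<open>W\<close> can be conjugated by a path in \<open>W\<close> into a loop
  at \<open>\<alpha>(1)\<close> inside \<open>V \<alpha>\<close>, so it is null-homotopic too. These neighbourhoods cover the path
  component of \<open>x0\<close>; its complement is open, again by local path connectedness, and completes the
  cover without contributing any generator.
\<close>

section \<open>Discrete coset topologies\<close>

text \<open>
  The identity is isolated iff some basic coset is \<open>{\<one>}\<close>, and a coset that is a singleton belongs
  to the trivial subgroup. Conversely, the cosets of the trivial subgroup are the singletons.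
\<close>

lemma (in group) coset_topology_discrete_iff:
  assumes sub: "\<And>i. P i \<Longrightarrow> subgroup (H i) G"
    and base: "openin T = arbitrary union_of (\<lambda>W. W \<in> {g <# H i |g i. g \<in> carrier G \<and> P i})"
    and top: "topspace T = carrier G"
  shows "T = discrete_topology (carrier G) \<longleftrightarrow> (\<exists>i. P i \<and> H i = {\<one>})"
proof
  assume "T = discrete_topology (carrier G)"
  then have "openin T {\<one>}" by simp
  then obtain g i where gi: "g \<in> carrier G" "P i" "\<one> \<in> g <# H i" "g <# H i \<subseteq> {\<one>}"
    unfolding base arbitrary_union_of_alt by blast
  interpret H: subgroup "H i" G using sub gi(2) .
  have "h = \<one>" if "h \<in> H i" for h
  proof -
    have coset: "g <# H i = (\<lambda>k. g \<otimes> k) ` H i" by (auto simp: l_coset_def)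
    have "g \<otimes> h = \<one>" "g \<otimes> \<one> = \<one>"
      using that H.one_closed gi(4) unfolding coset by (simp_all only: image_subset_iff singleton_iff)
    then show ?thesis using that gi(1) by simp
  qed
  then have "H i = {\<one>}" using H.one_closed by blast
  then show "\<exists>i. P i \<and> H i = {\<one>}" using gi(2) by blast
next
  assume "\<exists>i. P i \<and> H i = {\<one>}"
  then obtain i where i: "P i" "H i = {\<one>}" by blast
  have "openin T {g}" if g: "g \<in> carrier G" for g
  proof -
    have "g <# H i = {g}" using g i(2) by (simp add: l_coset_def)
    then have "{g} \<in> {g <# H i |g i. g \<in> carrier G \<and> P i}" using g i(1) by force
    then show ?thesis unfolding base by (rule arbitrary_union_of_inc)
  qed
  then show "T = discrete_topology (carrier G)"
    using top discrete_topology_unique by metis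
qed

lemma (in group) generate_eq_trivial_iff: "generate G A = {\<one>} \<longleftrightarrow> A \<subseteq> {\<one>}"
proof
  assume "generate G A = {\<one>}"
  then show "A \<subseteq> {\<one>}" using generate.incl[of _ A G] by blast
next
  assume "A \<subseteq> {\<one>}"
  then have "generate G A \<subseteq> {\<one>}" by (intro generate_subgroup_incl triv_subgroup)
  then show "generate G A = {\<one>}" using generate.one[of G A] by blast
qed


section \<open>Conjugates of null-homotopic loops\<close>

lemmas [trans] = homotopic_paths_trans

lemma conj_loop_null:
  assumes "path p" "path_image p \<subseteq> S"
    and "homotopic_paths S q (\<lambda>_. pathfinish p)"
  shows "homotopic_paths S (conj_loop p q) (\<lambda>_. pathstart p)"
proof -
  have q: "pathstart q = pathfinish p" "pathfinish q = pathfinish p"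
    using homotopic_paths_imp_pathstart[OF assms(3)] homotopic_paths_imp_pathfinish[OF assms(3)]
    by (auto simp: pathstart_def pathfinish_def)
  have "homotopic_paths S (q +++ reversepath p) ((\<lambda>_. pathfinish p) +++ reversepath p)"
    using assms q by (intro homotopic_paths_join) auto
  also have "homotopic_paths S ((\<lambda>_. pathfinish p) +++ reversepath p) (reversepath p)"
    using assms by (intro homotopic_paths_const_left) auto
  finally have "homotopic_paths S (p +++ (q +++ reversepath p)) (p +++ reversepath p)"
    using assms q by (intro homotopic_paths_join) auto
  also have "homotopic_paths S (p +++ reversepath p) (\<lambda>_. pathstart p)"
    using assms by (intro homotopic_paths_reverse_right) auto
  finally show ?thesis unfolding conj_loop_def .
qed

lemma homotopic_paths_cancel_left:
  assumes "path p" "path_image p \<subseteq> S" "path r" "path_image r \<subseteq> S" "pathstart r = pathfinish p"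
  shows "homotopic_paths S (reversepath p +++ (p +++ r)) r"
proof -
  have "homotopic_paths S (reversepath p +++ (p +++ r)) ((reversepath p +++ p) +++ r)"
    using assms by (intro homotopic_paths_assoc) auto
  also have "homotopic_paths S ((reversepath p +++ p) +++ r) ((\<lambda>_. pathfinish p) +++ r)"
    using assms homotopic_paths_reverse_right[of "reversepath p" S]
    by (intro homotopic_paths_join) auto
  also have "homotopic_paths S ((\<lambda>_. pathfinish p) +++ r) r"
    using assms by (intro homotopic_paths_const_left) auto
  finally show ?thesis .
qed

lemma homotopic_paths_cancel_right:
  assumes "path p" "path_image p \<subseteq> S" "path r" "path_image r \<subseteq> S" "pathfinish r = pathfinish p"
  shows "homotopic_paths S ((r +++ reversepath p) +++ p) r"
proof -
  have "homotopic_paths S ((r +++ reversepath p) +++ p) (r +++ (reversepath p +++ p))"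
    using assms by (intro homotopic_paths_sym[OF homotopic_paths_assoc]) auto
  also have "homotopic_paths S (r +++ (reversepath p +++ p)) (r +++ (\<lambda>_. pathfinish p))"
    using assms homotopic_paths_reverse_right[of "reversepath p" S]
    by (intro homotopic_paths_join) auto
  also have "homotopic_paths S (r +++ (\<lambda>_. pathfinish p)) r"
    using assms by (intro homotopic_paths_const_right) auto
  finally show ?thesis .
qed

text \<open>
  Conjugating \<open>p * q * p\<^sup>-\<^sup>1\<close> by \<open>p\<^sup>-\<^sup>1\<close> gives back \<open>q\<close> up to homotopy, so that the converse of
  \<open>conj_loop_null\<close> is an instance of \<open>conj_loop_null\<close> itself.
\<close>

lemma conj_loop_null_iff:
  assumes p: "path p" "path_image p \<subseteq> S" and q: "q \<in> loops_at S (pathfinish p)"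
  shows "homotopic_paths S (conj_loop p q) (\<lambda>_. pathstart p) \<longleftrightarrow>
         homotopic_paths S q (\<lambda>_. pathfinish p)"
proof
  assume "homotopic_paths S (conj_loop p q) (\<lambda>_. pathstart p)"
  then have null: "homotopic_paths S (conj_loop (reversepath p) (conj_loop p q)) (\<lambda>_. pathfinish p)"
    using p conj_loop_null[of "reversepath p" S "conj_loop p q"] by simp
  have q': "path q" "path_image q \<subseteq> S" "pathstart q = pathfinish p" "pathfinish q = pathfinish p"
    using q by (auto simp: loops_at_def)
  have qp: "path (q +++ reversepath p)" "path_image (q +++ reversepath p) \<subseteq> S"
    using p q' subset_path_image_join[of q S "reversepath p"] by auto
  have qpp: "path ((q +++ reversepath p) +++ p)" "path_image ((q +++ reversepath p) +++ p) \<subseteq> S"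
    using p q' qp subset_path_image_join[of "q +++ reversepath p" S p] by auto
  have "homotopic_paths S (conj_loop (reversepath p) (conj_loop p q))
      (reversepath p +++ (p +++ ((q +++ reversepath p) +++ p)))"
    unfolding conj_loop_def reversepath_reversepath
    using p q' qp
    by (intro homotopic_paths_join homotopic_paths_sym[OF homotopic_paths_assoc]) auto
  also have "homotopic_paths S \<dots> ((q +++ reversepath p) +++ p)"
    using p q' qpp by (intro homotopic_paths_cancel_left) auto
  also have "homotopic_paths S \<dots> q"
    using p q' by (intro homotopic_paths_cancel_right) auto
  finally show "homotopic_paths S q (\<lambda>_. pathfinish p)"
    using null by (blast intro: homotopic_paths_trans homotopic_paths_sym)
qed (rule conj_loop_null[OF p])

lemma class_conj_loop_eq_one_iff:
  assumes \<alpha>: "\<alpha> \<in> paths_from S x0" and \<beta>: "\<beta> \<in> loops_at U (pathfinish \<alpha>)" and "U \<subseteq> S"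
  shows "path_class S (conj_loop \<alpha> \<beta>) = \<one>\<^bsub>fundamental_group S x0\<^esub> \<longleftrightarrow>
         homotopic_paths S \<beta> (\<lambda>_. pathfinish \<alpha>)"
  using conj_loop_null_iff[of \<alpha> S \<beta>] loops_at_mono[OF \<beta> \<open>U \<subseteq> S\<close>] \<alpha>
    path_class_eq_iff[OF conj_loop_in_loops_at[OF \<alpha> \<beta> \<open>U \<subseteq> S\<close>]]
  by (simp add: one_fundamental_group paths_from_def)


section \<open>Discreteness in terms of small loops\<close>

lemma pi1_Span_discrete_iff:
  assumes "x0 \<in> S"
  shows "pi1_Span S x0 = discrete_topology (carrier (fundamental_group S x0)) \<longleftrightarrow>
    (\<exists>\<U>. open_cover S \<U> \<and>
      (\<forall>\<alpha>\<in>paths_from S x0. \<forall>U\<in>\<U>. \<forall>\<beta>\<in>loops_at U (pathfinish \<alpha>).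
         homotopic_paths S \<beta> (\<lambda>_. pathfinish \<alpha>)))"
proof -
  interpret group "fundamental_group S x0"
    using assms by (rule group_fundamental_group)
  have "Spanier_subgroup S \<U> x0 = {\<one>\<^bsub>fundamental_group S x0\<^esub>} \<longleftrightarrow>
      (\<forall>\<alpha>\<in>paths_from S x0. \<forall>U\<in>\<U>. \<forall>\<beta>\<in>loops_at U (pathfinish \<alpha>).
         homotopic_paths S \<beta> (\<lambda>_. pathfinish \<alpha>))" if "open_cover S \<U>" for \<U>
  proof -
    have "U \<subseteq> S" if "U \<in> \<U>" for U
      using that \<open>open_cover S \<U>\<close> by (auto simp: open_cover_def)
    then have *: "path_class S (conj_loop \<alpha> \<beta>) = \<one>\<^bsub>fundamental_group S x0\<^esub> \<longleftrightarrow>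
        homotopic_paths S \<beta> (\<lambda>_. pathfinish \<alpha>)"
      if "\<alpha> \<in> paths_from S x0" "U \<in> \<U>" "\<beta> \<in> loops_at U (pathfinish \<alpha>)" for \<alpha> U \<beta>
      using that class_conj_loop_eq_one_iff by metis
    have "Spanier_subgroup S \<U> x0 = {\<one>\<^bsub>fundamental_group S x0\<^esub>} \<longleftrightarrow>
      (\<forall>\<alpha>\<in>paths_from S x0. \<forall>U\<in>\<U>. \<forall>\<beta>\<in>loops_at U (pathfinish \<alpha>).
         path_class S (conj_loop \<alpha> \<beta>) = \<one>\<^bsub>fundamental_group S x0\<^esub>)"
      unfolding Spanier_subgroup_def generate_eq_trivial_iff by blast
    then show ?thesis using * by simp
  qed
  moreover have "pi1_Span S x0 = discrete_topology (carrier (fundamental_group S x0)) \<longleftrightarrow>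
      (\<exists>\<U>. open_cover S \<U> \<and> Spanier_subgroup S \<U> x0 = {\<one>\<^bsub>fundamental_group S x0\<^esub>})"
    using subgroup_Spanier[OF assms] openin_pi1_Span[OF assms, unfolded Spanier_basis_def]
      topspace_pi1_Span[OF assms]
    by (rule coset_topology_discrete_iff)
  ultimately show ?thesis by auto
qed

lemma pi1_pSpan_discrete_iff:
  assumes "x0 \<in> S"
  shows "pi1_pSpan S x0 = discrete_topology (carrier (fundamental_group S x0)) \<longleftrightarrow>
    (\<exists>V. path_open_cover S x0 V \<and>
      (\<forall>\<alpha>\<in>paths_from S x0. \<forall>\<beta>\<in>loops_at (V \<alpha>) (pathfinish \<alpha>).
         homotopic_paths S \<beta> (\<lambda>_. pathfinish \<alpha>)))"
proof -
  interpret group "fundamental_group S x0"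
    using assms by (rule group_fundamental_group)
  have "path_Spanier_subgroup S V x0 = {\<one>\<^bsub>fundamental_group S x0\<^esub>} \<longleftrightarrow>
      (\<forall>\<alpha>\<in>paths_from S x0. \<forall>\<beta>\<in>loops_at (V \<alpha>) (pathfinish \<alpha>).
         homotopic_paths S \<beta> (\<lambda>_. pathfinish \<alpha>))" if V: "path_open_cover S x0 V" for V
  proof -
    have "V \<alpha> \<subseteq> S" if "\<alpha> \<in> paths_from S x0" for \<alpha>
      using that V by (auto simp: path_open_cover_def dest: openin_imp_subset)
    then have *: "path_class S (conj_loop \<alpha> \<beta>) = \<one>\<^bsub>fundamental_group S x0\<^esub> \<longleftrightarrow>
        homotopic_paths S \<beta> (\<lambda>_. pathfinish \<alpha>)"
      if "\<alpha> \<in> paths_from S x0" "\<beta> \<in> loops_at (V \<alpha>) (pathfinish \<alpha>)" for \<alpha> \<beta>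
      using that class_conj_loop_eq_one_iff by metis
    have "path_Spanier_subgroup S V x0 = {\<one>\<^bsub>fundamental_group S x0\<^esub>} \<longleftrightarrow>
      (\<forall>\<alpha>\<in>paths_from S x0. \<forall>\<beta>\<in>loops_at (V \<alpha>) (pathfinish \<alpha>).
         path_class S (conj_loop \<alpha> \<beta>) = \<one>\<^bsub>fundamental_group S x0\<^esub>)"
      unfolding path_Spanier_subgroup_eq_generate[OF assms V] generate_eq_trivial_iff by blast
    then show ?thesis using * by simp
  qed
  moreover have "pi1_pSpan S x0 = discrete_topology (carrier (fundamental_group S x0)) \<longleftrightarrow>
      (\<exists>V. path_open_cover S x0 V \<and> path_Spanier_subgroup S V x0 = {\<one>\<^bsub>fundamental_group S x0\<^esub>})"
    using subgroup_path_Spanier[OF assms] openin_pi1_pSpan[OF assms, unfolded path_Spanier_basis_def]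
      topspace_pi1_pSpan[OF assms]
    by (rule coset_topology_discrete_iff)
  ultimately show ?thesis by auto
qed


section \<open>Passing between the two kinds of covers\<close>

lemma open_cover_imp_path_open_cover:
  assumes "open_cover S \<U>"
  obtains V where "path_open_cover S x0 V" "\<And>\<alpha>. \<alpha> \<in> paths_from S x0 \<Longrightarrow> V \<alpha> \<in> \<U>"
proof -
  have "\<exists>U\<in>\<U>. pathfinish \<alpha> \<in> U" if "\<alpha> \<in> paths_from S x0" for \<alpha>
    using that assms by (auto simp: paths_from_def open_cover_def)
  then obtain V where "\<forall>\<alpha>\<in>paths_from S x0. V \<alpha> \<in> \<U> \<and> pathfinish \<alpha> \<in> V \<alpha>"
    by metis
  then show ?thesis
    using assms that[of V] by (auto simp: path_open_cover_def open_cover_def)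
qed

lemma path_component_imp_paths_from:
  assumes "path_component S x y"
  obtains \<alpha> where "\<alpha> \<in> paths_from S x" "pathfinish \<alpha> = y"
proof -
  obtain g where g: "path g" "path_image g \<subseteq> S" "pathstart g = x" "pathfinish g = y"
    using assms by (auto simp: path_component_def)
  let ?\<alpha> = "restrict g {0..1}"
  have "path ?\<alpha>"
    using g(1) unfolding path_def by (rule continuous_on_eq) simp
  then have "?\<alpha> \<in> paths_from S x"
    using g by (auto simp: paths_from_def path_image_def pathstart_def)
  moreover have "pathfinish ?\<alpha> = y"
    using g(4) by (simp add: pathfinish_def)
  ultimately show ?thesis by (rule that)
qed

lemma paths_from_pathfinish_component:
  "\<alpha> \<in> paths_from S x \<Longrightarrow> path_component S x (pathfinish \<alpha>)"
  by (auto simp: paths_from_def path_component_def)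

text \<open>
  Null-homotopy of the loops of \<open>V\<close> at one point \<open>x\<close> spreads to the loops at every point of a path
  connected \<open>W \<subseteq> V\<close>: conjugating with a path in \<open>W\<close> moves their base point to \<open>x\<close>.
\<close>

lemma loops_null_path_connected:
  assumes W: "path_connected W" "x \<in> W" "W \<subseteq> V" "V \<subseteq> S"
    and null: "\<And>\<beta>. \<beta> \<in> loops_at V x \<Longrightarrow> homotopic_paths S \<beta> (\<lambda>_. x)"
    and \<beta>: "\<beta> \<in> loops_at W y"
  shows "homotopic_paths S \<beta> (\<lambda>_. y)"
proof -
  have "y \<in> W"
    using \<beta> by (auto simp: loops_at_def)
  then obtain \<gamma> where \<gamma>: "\<gamma> \<in> paths_from W x" "pathfinish \<gamma> = y"
    using W(1,2) path_component_imp_paths_from unfolding path_connected_component by metis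
  have "conj_loop \<gamma> \<beta> \<in> loops_at W x"
    using \<gamma> \<beta> by (intro conj_loop_in_loops_at[of _ _ _ _ W]) auto
  then have "homotopic_paths S (conj_loop \<gamma> \<beta>) (\<lambda>_. x)"
    using null W(3) loops_at_mono by blast
  moreover have "\<beta> \<in> loops_at S y"
    using \<beta> W(3,4) loops_at_mono by blast
  ultimately show ?thesis
    using conj_loop_null_iff[of \<gamma> S \<beta>] \<gamma> W(3,4) by (auto simp: paths_from_def)
qed

lemma path_open_cover_imp_open_cover:
  assumes lpc: "locally path_connected S" and V: "path_open_cover S x0 V"
    and null: "\<And>\<alpha> \<beta>. \<alpha> \<in> paths_from S x0 \<Longrightarrow> \<beta> \<in> loops_at (V \<alpha>) (pathfinish \<alpha>)
      \<Longrightarrow> homotopic_paths S \<beta> (\<lambda>_. pathfinish \<alpha>)"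
  obtains \<U> where "open_cover S \<U>"
    "\<And>\<alpha> U \<beta>. \<alpha> \<in> paths_from S x0 \<Longrightarrow> U \<in> \<U> \<Longrightarrow> \<beta> \<in> loops_at U (pathfinish \<alpha>)
      \<Longrightarrow> homotopic_paths S \<beta> (\<lambda>_. pathfinish \<alpha>)"
proof -
  let ?C = "path_component_set S x0"
  have V\<alpha>: "openin (top_of_set S) (V \<alpha>)" "pathfinish \<alpha> \<in> V \<alpha>" if "\<alpha> \<in> paths_from S x0" for \<alpha>
    using V that by (auto simp: path_open_cover_def)
  define \<W> where "\<W> = {W. openin (top_of_set S) W \<and> path_connected W \<and>
    (\<exists>\<alpha>\<in>paths_from S x0. pathfinish \<alpha> \<in> W \<and> W \<subseteq> V \<alpha>)}"
  have cover: "\<exists>W\<in>\<W>. y \<in> W" if y: "y \<in> ?C" for y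
  proof -
    obtain \<alpha> where \<alpha>: "\<alpha> \<in> paths_from S x0" "pathfinish \<alpha> = y"
      using y path_component_imp_paths_from by blast
    then obtain W where "openin (top_of_set S) W" "path_connected W" "y \<in> W" "W \<subseteq> V \<alpha>"
      using lpc V\<alpha>[OF \<alpha>(1)] unfolding locally_path_connected by metis
    then show ?thesis using \<alpha> by (auto simp: \<W>_def)
  qed
  have "openin (top_of_set S) (S - ?C)"
    using closedin_path_component_locally_path_connected[OF lpc, of x0]
    by (auto simp: closedin_def)
  moreover have "W \<subseteq> S" if "W \<in> \<W>" for W
    using that by (auto simp: \<W>_def dest: openin_imp_subset)
  ultimately have "open_cover S (insert (S - ?C) \<W>)"
    using cover unfolding open_cover_def by (auto simp: \<W>_def)
  moreover have "homotopic_paths S \<beta> (\<lambda>_. pathfinish \<alpha>)"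
    if \<alpha>: "\<alpha> \<in> paths_from S x0" and U: "U \<in> insert (S - ?C) \<W>"
      and \<beta>: "\<beta> \<in> loops_at U (pathfinish \<alpha>)" for \<alpha> U \<beta>
  proof -
    have "pathfinish \<alpha> \<in> U"
      using \<beta> by (auto simp: loops_at_def)
    then have "U \<in> \<W>"
      using U paths_from_pathfinish_component[OF \<alpha>] by auto
    then obtain \<delta> where "path_connected U" "\<delta> \<in> paths_from S x0" "pathfinish \<delta> \<in> U" "U \<subseteq> V \<delta>"
      by (auto simp: \<W>_def)
    then show ?thesis
      using loops_null_path_connected[OF _ _ _ _ null \<beta>] V\<alpha>(1) openin_imp_subset by metis
  qed
  ultimately show ?thesis by (rule that)
qed

theorem proposition3p7:
  fixes S :: "'a::topological_space set" and x0 :: 'a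
  assumes "locally path_connected S" and "x0 \<in> S"
  shows "pi1_pSpan S x0 = discrete_topology (carrier (fundamental_group S x0)) \<longleftrightarrow>
         pi1_Span S x0 = discrete_topology (carrier (fundamental_group S x0))"
  unfolding pi1_pSpan_discrete_iff[OF assms(2)] pi1_Span_discrete_iff[OF assms(2)]
proof (intro iffI; elim exE conjE)
  fix V assume "path_open_cover S x0 V"
    "\<forall>\<alpha>\<in>paths_from S x0. \<forall>\<beta>\<in>loops_at (V \<alpha>) (pathfinish \<alpha>).
       homotopic_paths S \<beta> (\<lambda>_. pathfinish \<alpha>)"
  then show "\<exists>\<U>. open_cover S \<U> \<and>
      (\<forall>\<alpha>\<in>paths_from S x0. \<forall>U\<in>\<U>. \<forall>\<beta>\<in>loops_at U (pathfinish \<alpha>).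
         homotopic_paths S \<beta> (\<lambda>_. pathfinish \<alpha>))"
    using path_open_cover_imp_open_cover[OF assms(1)] by metis
next
  fix \<U> assume "open_cover S \<U>"
    "\<forall>\<alpha>\<in>paths_from S x0. \<forall>U\<in>\<U>. \<forall>\<beta>\<in>loops_at U (pathfinish \<alpha>).
       homotopic_paths S \<beta> (\<lambda>_. pathfinish \<alpha>)"
  then show "\<exists>V. path_open_cover S x0 V \<and>
      (\<forall>\<alpha>\<in>paths_from S x0. \<forall>\<beta>\<in>loops_at (V \<alpha>) (pathfinish \<alpha>).
         homotopic_paths S \<beta> (\<lambda>_. pathfinish \<alpha>))"
    using open_cover_imp_path_open_cover by metis
qed

end
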